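(* Suppose that: (Assumption 1) for each $i\in\mathcal N$, $J_i(x_i;x_{-i})$ is a proper, lower semicontinuous, convex function of $x_i$ for any fixed $x_{-i}$; (Assumption 2) each $\Omega_i$ is nonempty, closed and convex, and $\mathcal X$ is nonempty and satisfies Slater's constraint qualification; (Assumption 3) the communication graph $\mathcal G$ is directed, weakly connected and has no self-loops. (i) If $\omega^*=[\mathbf y^*;\boldsymbol\lambda^*;\boldsymbol\mu^*;\mathbf z^*]\in\mathrm{Zer}(\mathcal T)$, then there exist $y^*\in\mathbb R^n$ and $\lambda^*\in\mathbb R^m$ such that $\mathbf y^*=\mathbf 1_N\otimes y^*$, $\boldsymbol\lambda^*=\mathbf 1_N\otimes\lambda^*$, and $(y^*,\lambda^* )$ satisfies the v-GNE KKT conditions, i.e. with $x=y^*$, $\lambda=\lambda^*$, $$\mathbf 0\in\partial_{x_i}J_i(x_i;x_{-i})+A_i^T\lambda+N_{\Omega_i}(x_i)\ \ \forall i\in\mathcal N,\qquad \mathbf 0\in-(Ax-b)+N_{\mathbb R_+^m}(\lambda).$$ (ii) Conversely, for every v-GNE $(y^\dagger,\lambda^\dagger)$ of the game (i.e. every pair satisfying these KKT conditions with $x=y^\dagger$, $\lambda=\lambda^\dagger$), there exist $\boldsymbol\mu^\dagger$ and $\mathbf z^\dagger$ such that $[\mathbf 1_N\otimes y^\dagger;\mathbf 1_N\otimes\lambda^\dagger;\boldsymbol\mu^\dagger;\mathbf z^\dagger]\in\mathrm{Zer}(\mathcal T)$.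
   Context: Game. Players $\mathcal N=\{1,\dots,N\}$. Player $i$ has decision $x_i\in\Omega_i\subseteq\mathbb R^{n_i}$; $n=\sum_i n_i$, $x=[x_1;\dots;x_N]\in\mathbb R^n$ (vertical stack), $x_{-i}$ is the stack of the other players' decisions. Given $x_{-i}$, player $i$ minimizes $J_i(x_i;x_{-i})$ (values in $\mathbb R\cup\{+\infty\}$) over $x_i\in\Omega_i$ subject to $A_ix_i\le b-\sum_{j\ne i}A_jx_j$, where $A_i\in\mathbb R^{m\times n_i}$, $b\in\mathbb R^m$. Put $A=[A_1,\dots,A_N]$, $\Omega=\prod_i\Omega_i$, $\mathcal X=\Omega\cap\{x\in\mathbb R^n: Ax-b\le\mathbf 0\}$. $N_S(x)$ is the normal cone: $\{u:\sup_{z\in S}\langle u,z-x\rangle\le0\}$ if $x\in S$, and $\emptyset$ otherwise. Network. $\mathcal G=(\mathcal N,\mathcal E_g)$ is a directed graph on the players with $E_g=|\mathcal E_g|$ edges; $(j,i)$ denotes an edge with tail $j$ and head $i$. $B\in\mathbb R^{N\times E_g}$ is its incidence matrix (in the column of edge $(j,i)$: $+1$ in row $i$, $-1$ in row $j$, zeros elsewhere), $L=BB^T$ its Laplacian. $B_n=B\otimes I_n$, $L_n=L\otimes I_n$, $B_m=B\otimes I_m$, $L_m=L\otimes I_m$. Augmented variables. Each player $i$ holds $y_i=(y_i^1,\dots,y_i^N)\in\mathbb R^n$, with $y_i^j\in\mathbb R^{n_j}$ ($y_i^i$ its own decision, $y_i^{-i}$ the stack of its estimates $y_i^j$, $j\neq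 i$, of the others' decisions), and $\lambda_i\in\mathbb R^m$; each edge $(j,i)$ has $\mu_{ji}\in\mathbb R^n$, $z_{ji}\in\mathbb R^m$. $\mathbf y\in\mathbb R^{nN},\boldsymbol\lambda\in\mathbb R^{mN},\boldsymbol\mu\in\mathbb R^{nE_g},\mathbf z\in\mathbb R^{mE_g}$ are the corresponding stacks. $\tilde\Omega=\prod_i\tilde\Omega_i$ with $\tilde\Omega_i=\{y_i\in\mathbb R^n: y_i^i\in\Omega_i\}$. $\mathcal R_i\in\mathbb R^{n_i\times n}$ is the selection matrix with $\mathcal R_iy_i=y_i^i$; $\mathcal R=\mathrm{blkd}(\mathcal R_1,\dots,\mathcal R_N)$ and $\Lambda=\mathrm{blkd}(A_1,\dots,A_N)$ (block diagonal). $\mathbf b=[b_1;\dots;b_N]$ where $b_i\in\mathbb R^m$ are arbitrary fixed vectors with $\sum_ib_i=b$. The extended pseudogradient is $\mathcal F:\mathbf y\mapsto[\partial_{y_i^i}J_i(y_i^i;y_i^{-i})]_{i\in\mathcal N}$ (set-valued, $\mathbb R^{nN}\rightrightarrows\mathbb R^n$). $\rho_\mu,\rho_z\ge0$ are constants. Operator: $\mathcal T$ maps $[\mathbf y;\boldsymbol\lambda;\boldsymbol\mu;\mathbf z]$ to $$\begin{bmatrix}\mathcal R^T(\mathcal F(\mathbf y)+\Lambda^T\boldsymbol\lambda)+B_n\boldsymbol\mu+\rho_\mu L_n\mathbf y+N_{\tilde\Omega}(\mathbf y)\\ N_{\mathbb R_+^{mN}}(\boldsymbol\lambda)-\Lambda\mathcal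 R\mathbf y+\mathbf b+B_m\mathbf z+\rho_zL_m\boldsymbol\lambda\\ -B_n^T\mathbf y\\ -B_m^T\boldsymbol\lambda\end{bmatrix}.$$ $\mathrm{Zer}(\mathcal T)=\{\omega:\mathbf 0\in\mathcal T\omega\}$. $\mathbf 1_N$ is the all-ones vector, $\otimes$ the Kronecker product. *)

theory Defs
  imports "HOL-Analysis.Analysis"
begin

text \<open>
  Players are the elements of a finite type \<open>'p\<close>, so $N$ is its cardinality.  The scalar
  coordinates of $\mathbb{R}^n$ are indexed by a finite type \<open>'c\<close>, and \<open>own :: 'c \<Rightarrow> 'p\<close> says
  which player a coordinate belongs to, so that $n_i$ is the number of \<open>c\<close> with \<open>own c = i\<close>.
  $\mathbb{R}^{n_i}$ is the coordinate subspace \<open>block_space own i\<close> of $\mathbb{R}^n$.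
  Stacks of \<open>K\<close> vectors are indexed by pairs (stack position, inner index).

  A function on $\mathbb{R}^{n_i}$ is a function on \<open>real^'c\<close> regarded on \<open>block_space own i\<close>
  only; therefore the notions of convex analysis below take the ambient subspace \<open>V\<close> as a
  parameter.
\<close>

definition proper_on :: "'a set \<Rightarrow> ('a \<Rightarrow> ereal) \<Rightarrow> bool" where
  "proper_on V f \<longleftrightarrow> (\<forall>x\<in>V. f x \<noteq> -\<infinity>) \<and> (\<exists>x\<in>V. f x \<noteq> \<infinity>)"

definition lsc_on :: "'a::topological_space set \<Rightarrow> ('a \<Rightarrow> ereal) \<Rightarrow> bool" where
  "lsc_on V f \<longleftrightarrow> (\<forall>x\<in>V. f x \<le> Liminf (at x within V) f)"

definition ereal_convex_on :: "'a::real_vector set \<Rightarrow> ('a \<Rightarrow> ereal) \<Rightarrow> bool" where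
  "ereal_convex_on V f \<longleftrightarrow> convex V \<and>
     (\<forall>x\<in>V. \<forall>y\<in>V. \<forall>t::real. 0 < t \<and> t < 1 \<longrightarrow>
        f ((1 - t) *\<^sub>R x + t *\<^sub>R y) \<le> ereal (1 - t) * f x + ereal t * f y)"

definition subdifferential ::
    "'a::real_inner set \<Rightarrow> ('a \<Rightarrow> ereal) \<Rightarrow> 'a \<Rightarrow> 'a set" where
  "subdifferential V f x = {g \<in> V. \<forall>z\<in>V. f x + ereal (g \<bullet> (z - x)) \<le> f z}"

definition normal_cone :: "'a::real_inner set \<Rightarrow> 'a set \<Rightarrow> 'a \<Rightarrow> 'a set" where
  "normal_cone V S x =
     (if x \<in> S then {u \<in> V. (SUP z\<in>S. ereal (u \<bullet> (z - x))) \<le> 0} else {})"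

definition nonneg_orthant :: "(real^'k) set" where
  "nonneg_orthant = {v. \<forall>k. 0 \<le> v $ k}"

definition kron :: "real^'b::finite^'a::finite \<Rightarrow> real^'d::finite^'c::finite \<Rightarrow> real^('b \<times> 'd)^('a \<times> 'c)" where
  "kron M M' = (\<chi> r s. M $ fst r $ fst s * M' $ snd r $ snd s)"

definition kron_vec :: "real^'a::finite \<Rightarrow> real^'b::finite \<Rightarrow> real^('a \<times> 'b)" where
  "kron_vec u v = (\<chi> r. u $ fst r * v $ snd r)"

definition block_space :: "('c \<Rightarrow> 'p) \<Rightarrow> 'p \<Rightarrow> (real^'c) set" where
  "block_space own i = {v. \<forall>c. own c \<noteq> i \<longrightarrow> v $ c = 0}"

text \<open>\<open>block own i x\<close> is $x_i$; \<open>subst_block own i u x\<close> is the decision vector $(u; x_{-i})$.\<close>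

definition block :: "('c \<Rightarrow> 'p) \<Rightarrow> 'p \<Rightarrow> real^'c \<Rightarrow> real^'c" where
  "block own i x = (\<chi> c. if own c = i then x $ c else 0)"

definition subst_block :: "('c \<Rightarrow> 'p) \<Rightarrow> 'p \<Rightarrow> real^'c \<Rightarrow> real^'c \<Rightarrow> real^'c" where
  "subst_block own i u x = (\<chi> c. if own c = i then u $ c else x $ c)"

text \<open>The columns $A_i$ of $A = [A_1, \dots, A_N]$; the columns of the other players are zero.\<close>

definition col_block :: "('c \<Rightarrow> 'p) \<Rightarrow> real^'c^'m \<Rightarrow> 'p \<Rightarrow> real^'c^'m" where
  "col_block own A i = (\<chi> k c. if own c = i then A $ k $ c else 0)"

text \<open>The cost \<open>J i\<close> takes the whole decision vector; \<open>partial_cost own J i x\<close> is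
  $u \mapsto J_i(u; x_{-i})$.\<close>

definition partial_cost ::
    "('c \<Rightarrow> 'p) \<Rightarrow> ('p \<Rightarrow> real^'c \<Rightarrow> ereal) \<Rightarrow> 'p \<Rightarrow> real^'c \<Rightarrow> real^'c \<Rightarrow> ereal" where
  "partial_cost own J i x u = J i (subst_block own i u x)"

definition partial_subdiff ::
    "('c::finite \<Rightarrow> 'p) \<Rightarrow> ('p \<Rightarrow> real^'c \<Rightarrow> ereal) \<Rightarrow> 'p \<Rightarrow> real^'c \<Rightarrow> (real^'c) set" where
  "partial_subdiff own J i x =
     subdifferential (block_space own i) (partial_cost own J i x) (block own i x)"

definition joint_set :: "('c \<Rightarrow> 'p) \<Rightarrow> ('p \<Rightarrow> (real^'c) set) \<Rightarrow> (real^'c) set" where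
  "joint_set own \<Omega> = {x. \<forall>i. block own i x \<in> \<Omega> i}"

definition feasible_set ::
    "('c::finite \<Rightarrow> 'p) \<Rightarrow> ('p \<Rightarrow> (real^'c) set) \<Rightarrow> real^'c^'m \<Rightarrow> real^'m \<Rightarrow> (real^'c) set" where
  "feasible_set own \<Omega> A b = joint_set own \<Omega> \<inter> {x. \<forall>k. (A *v x - b) $ k \<le> 0}"

definition slater ::
    "('c::finite \<Rightarrow> 'p) \<Rightarrow> ('p \<Rightarrow> (real^'c) set) \<Rightarrow> real^'c^'m \<Rightarrow> real^'m \<Rightarrow> bool" where
  "slater own \<Omega> A b \<longleftrightarrow> (\<exists>x \<in> rel_interior (joint_set own \<Omega>). \<forall>k. (A *v x - b) $ k < 0)"

definition vGNE ::
    "('c::finite \<Rightarrow> 'p) \<Rightarrow> ('p \<Rightarrow> real^'c \<Rightarrow> ereal) \<Rightarrow> ('p \<Rightarrow> (real^'c) set) \<Rightarrow>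
     real^'c^'m \<Rightarrow> real^'m \<Rightarrow> real^'c \<Rightarrow> real^'m \<Rightarrow> bool" where
  "vGNE own J \<Omega> A b x l \<longleftrightarrow>
     (\<forall>i. 0 \<in> partial_subdiff own J i x + {transpose (col_block own A i) *v l}
               + normal_cone (block_space own i) (\<Omega> i) (block own i x)) \<and>
     0 \<in> {- (A *v x - b)} + normal_cone UNIV nonneg_orthant l"

text \<open>The edge set \<open>E\<close> consists of pairs (tail, head).  $\mathbb{R}^{E_g}$ is represented by the
  vectors indexed by all ordered pairs of players that vanish off \<open>E\<close>; accordingly the incidence
  matrix has a zero column for every pair that is not an edge.\<close>

definition weakly_connected :: "('p \<times> 'p) set \<Rightarrow> bool" where
  "weakly_connected E \<longleftrightarrow> (\<forall>i j. (i, j) \<in> (E \<union> E\<inverse>)\<^sup>*)"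

definition incidence :: "('p::finite \<times> 'p) set \<Rightarrow> real^('p \<times> 'p)^'p" where
  "incidence E = (\<chi> i e. if e \<notin> E then 0
                        else if i = snd e then 1 else if i = fst e then -1 else 0)"

definition laplacian :: "('p::finite \<times> 'p) set \<Rightarrow> real^'p^'p" where
  "laplacian E = incidence E ** transpose (incidence E)"

definition edge_space :: "('p::finite \<times> 'p) set \<Rightarrow> (real^(('p \<times> 'p) \<times> 'k::finite)) set" where
  "edge_space E = {w. \<forall>e k. e \<notin> E \<longrightarrow> w $ (e, k) = 0}"

text \<open>\<open>copy y i\<close> is player \<open>i\<close>'s vector $y_i$.\<close>

definition copy :: "real^('p::finite \<times> 'c::finite) \<Rightarrow> 'p \<Rightarrow> real^'c" where
  "copy y i = (\<chi> c. y $ (i, c))"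

definition stack :: "('p::finite \<Rightarrow> real^'k::finite) \<Rightarrow> real^('p \<times> 'k)" where
  "stack v = (\<chi> r. v (fst r) $ snd r)"

definition aug_set :: "('c::finite \<Rightarrow> 'p::finite) \<Rightarrow> ('p \<Rightarrow> (real^'c) set) \<Rightarrow> (real^('p \<times> 'c)) set" where
  "aug_set own \<Omega> = {y. \<forall>i. block own i (copy y i) \<in> \<Omega> i}"

text \<open>$\mathcal{R} = \mathrm{blkd}(\mathcal{R}_1, \dots, \mathcal{R}_N)$ and
  $\Lambda = \mathrm{blkd}(A_1, \dots, A_N)$.  Row \<open>c\<close> of the first lies in the row block of
  player \<open>own c\<close>, and so does column \<open>c\<close> of the second.\<close>

definition sel_mat :: "('c::finite \<Rightarrow> 'p::finite) \<Rightarrow> real^('p \<times> 'c)^'c" where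
  "sel_mat own = (\<chi> c r. if fst r = own c \<and> snd r = c then 1 else 0)"

definition Lam_mat :: "('c::finite \<Rightarrow> 'p::finite) \<Rightarrow> real^'c^'m::finite \<Rightarrow> real^'c^('p \<times> 'm)" where
  "Lam_mat own A = (\<chi> r c. if fst r = own c then A $ snd r $ c else 0)"

definition ext_pseudograd ::
    "('c::finite \<Rightarrow> 'p::finite) \<Rightarrow> ('p \<Rightarrow> real^'c \<Rightarrow> ereal) \<Rightarrow> real^('p \<times> 'c) \<Rightarrow> (real^'c) set" where
  "ext_pseudograd own J y = {g. \<forall>i. block own i g \<in> partial_subdiff own J i (copy y i)}"

type_synonym ('p, 'c, 'm) aug_vars =
  "(real^('p \<times> 'c)) \<times> (real^('p \<times> 'm)) \<times> (real^(('p \<times> 'p) \<times> 'c)) \<times> (real^(('p \<times> 'p) \<times> 'm))"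

text \<open>The parameter \<open>bs\<close> is the family $(b_i)_i$.\<close>

definition op_T ::
    "('c::finite \<Rightarrow> 'p::finite) \<Rightarrow> ('p \<Rightarrow> real^'c \<Rightarrow> ereal) \<Rightarrow> ('p \<Rightarrow> (real^'c) set) \<Rightarrow>
     real^'c^'m::finite \<Rightarrow> ('p \<Rightarrow> real^'m) \<Rightarrow> ('p \<times> 'p) set \<Rightarrow> real \<Rightarrow> real \<Rightarrow>
     ('p, 'c, 'm) aug_vars \<Rightarrow>
     ('p, 'c, 'm) aug_vars set" where
  "op_T own J \<Omega> A bs E \<rho>\<mu> \<rho>z = (\<lambda>(y, l, \<mu>, z).
     (let R = sel_mat own;
          \<Lambda> = Lam_mat own A;
          B\<^sub>n = kron (incidence E) (mat 1 :: real^'c^'c);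
          L\<^sub>n = kron (laplacian E) (mat 1 :: real^'c^'c);
          B\<^sub>m = kron (incidence E) (mat 1 :: real^'m^'m);
          L\<^sub>m = kron (laplacian E) (mat 1 :: real^'m^'m)
      in ((\<lambda>g. transpose R *v (g + transpose \<Lambda> *v l)) ` ext_pseudograd own J y
            + {B\<^sub>n *v \<mu> + \<rho>\<mu> *\<^sub>R (L\<^sub>n *v y)} + normal_cone UNIV (aug_set own \<Omega>) y)
       \<times> (normal_cone UNIV nonneg_orthant l
            + {- (\<Lambda> *v (R *v y)) + stack bs + B\<^sub>m *v z + \<rho>z *\<^sub>R (L\<^sub>m *v l)})
       \<times> {- (transpose B\<^sub>n *v y)}
       \<times> {- (transpose B\<^sub>m *v l)}))"

definition Zer_T ::
    "('c::finite \<Rightarrow> 'p::finite) \<Rightarrow> ('p \<Rightarrow> real^'c \<Rightarrow> ereal) \<Rightarrow> ('p \<Rightarrow> (real^'c) set) \<Rightarrow>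
     real^'c^'m::finite \<Rightarrow> ('p \<Rightarrow> real^'m) \<Rightarrow> ('p \<times> 'p) set \<Rightarrow> real \<Rightarrow> real \<Rightarrow>
     ('p, 'c, 'm) aug_vars set" where
  "Zer_T own J \<Omega> A bs E \<rho>\<mu> \<rho>z =
     {\<omega> \<in> UNIV \<times> UNIV \<times> edge_space E \<times> edge_space E. 0 \<in> op_T own J \<Omega> A bs E \<rho>\<mu> \<rho>z \<omega>}"

end

theory Submission
  imports Defs
begin

text \<open>
  The last two rows of $\mathcal T$ say that the decision estimates and the multipliers agree along
  every edge; on a weakly connected graph this forces $\mathbf y = \mathbf 1 \otimes y$ and
  $\boldsymbol\lambda = \mathbf 1 \otimes \lambda$ (lemma \<open>incidence_transpose_eq_0_iff_consensus\<close>).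
  On such consensual points the Laplacian terms vanish, so what separates the first two rows from
  the KKT system are the edge terms $B_n\mu$ and $B_m z$ and the way in which the players share the
  normal vectors.

  From a zero to a v-GNE, one adds up the players' components of each row.  The edge
  terms cancel, because without self-loops each column of the incidence matrix sums to zero
  (lemma \<open>sum_kron_incidence\<close>).  A normal vector of $\tilde\Omega$ vanishes at the
  unconstrained estimates and restricts to normal vectors of the $\Omega_i$
  (lemma \<open>normal_cone_aug_set_iff\<close>), so in the sum of the first row every coordinate receives
  exactly the terms of the player who owns it.  The sum of the second row is complementarity for the
  coupling constraint, because a normal vector of the big orthant at
  $\mathbf 1 \otimes \lambda$, tested against consensual points, sums to a normal vector of
  the small orthant at $\lambda$.

  From a v-GNE to a zero, the first row is solvable with $\mu = 0$, since it couples no two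
  players once the normal vectors are extended by zero to the estimates.  In the second row the KKT
  system determines only the sum over the players: giving each player the share
  $(Ay - b)/N$ of the normal vector leaves a residual that sums to zero over the players, and
  weak connectivity makes every such residual a flow divergence $B_m z$
  (lemma \<open>zero_sum_in_range_kron_incidence\<close>).
\<close>

\<comment> \<open>The componentwise rules for transposed matrices below match \<open>transpose M *v x\<close>, which this
  simplification rule would turn into \<open>x v* M\<close>.\<close>
declare transpose_matrix_vector [simp del]

section \<open>Stacked vectors\<close>

lemma copy_nth [simp]: "copy y i $ c = y $ (i, c)"
  by (simp add: copy_def)

lemma copy_diff [simp]: "copy (y - z) i = copy y i - copy z i"
  by (simp add: vec_eq_iff)

lemma copy_stack [simp]: "copy (stack v) i = v i"
  by (simp add: vec_eq_iff stack_def)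

lemma copy_kron_vec_1 [simp]: "copy (kron_vec 1 v) i = v"
  by (simp add: vec_eq_iff kron_vec_def)

lemma kron_vec_1_nth [simp]: "kron_vec 1 v $ (i, c) = v $ c"
  by (simp add: kron_vec_def)

lemma sum_UNIV_prod:
  "(\<Sum>r\<in>UNIV. f r) = (\<Sum>i\<in>UNIV. \<Sum>c\<in>UNIV. f (i :: 'a::finite, c :: 'b::finite))"
  by (simp add: sum.cartesian_product flip: UNIV_Times_UNIV)

lemma stacked_eq_0_iff: "x = 0 \<longleftrightarrow> (\<forall>i c. x $ (i, c) = 0)"
  by (simp add: vec_eq_iff)

lemma inner_eq_sum_copies: "u \<bullet> w = (\<Sum>i\<in>UNIV. copy u i \<bullet> copy w i)"
  by (simp add: inner_vec_def sum_UNIV_prod)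

lemma kron_mat_1_mult_nth:
  "(kron M (mat 1) *v w) $ (i, k) = (\<Sum>e\<in>UNIV. M $ i $ e * w $ (e, k))"
  by (simp add: matrix_vector_mult_def kron_def mat_def sum_UNIV_prod mult_delta_left
      mult_delta_right)

lemma transpose_kron_mat_1: "transpose (kron M (mat 1)) = kron (transpose M) (mat 1)"
  by (simp add: vec_eq_iff transpose_def kron_def mat_def eq_commute)

lemma kron_mat_1_mult_assoc:
  "kron (M ** M') (mat 1) *v w = kron M (mat 1) *v (kron M' (mat 1) *v w)"
proof -
  have "(kron (M ** M') (mat 1) *v w) $ (i, k) = (kron M (mat 1) *v (kron M' (mat 1) *v w)) $ (i, k)"
    for i k
    by (simp add: kron_mat_1_mult_nth matrix_matrix_mult_def sum_distrib_left sum_distrib_right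
        mult.assoc, rule sum.swap)
  then show ?thesis by (simp add: vec_eq_iff split_paired_all)
qed

section \<open>The incidence matrix of a weakly connected graph\<close>

lemma sum_incidence_column:
  assumes "irrefl E"
  shows "(\<Sum>i\<in>UNIV. incidence E $ i $ e) = 0"
proof (cases "e \<in> E")
  case True
  then have "fst e \<noteq> snd e"
    using assms by (metis irrefl_def prod.collapse)
  then have "incidence E $ i $ e = (if i = snd e then 1 else 0) - (if i = fst e then 1 else 0)" for i
    using True by (simp add: incidence_def)
  then show ?thesis by (simp add: sum_subtractf)
qed (simp add: incidence_def)

lemma sum_kron_incidence:
  assumes "irrefl E"
  shows "(\<Sum>i\<in>UNIV. (kron (incidence E) (mat 1) *v w) $ (i, k)) = 0"
proof -
  have "(\<Sum>i\<in>UNIV. (kron (incidence E) (mat 1) *v w) $ (i, k))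
      = (\<Sum>e\<in>UNIV. (\<Sum>i\<in>UNIV. incidence E $ i $ e) * w $ (e, k))"
    by (simp add: kron_mat_1_mult_nth sum_distrib_right, rule sum.swap)
  then show ?thesis by (simp add: sum_incidence_column[OF assms])
qed

lemma transpose_kron_incidence_nth:
  assumes "irrefl E"
  shows "(transpose (kron (incidence E) (mat 1)) *v y) $ ((j, i), k)
    = (if (j, i) \<in> E then y $ (i, k) - y $ (j, k) else 0)"
proof (cases "(j, i) \<in> E")
  case True
  then have "j \<noteq> i"
    using assms by (auto simp: irrefl_def)
  then have "incidence E $ p $ (j, i) * y $ (p, k)
      = (if p = i then y $ (p, k) else 0) - (if p = j then y $ (p, k) else 0)" for p
    using True by (simp add: incidence_def)
  then show ?thesis
    using True
    by (simp add: transpose_kron_mat_1 kron_mat_1_mult_nth)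
      (simp add: transpose_def sum_subtractf)
qed (simp add: transpose_kron_mat_1 kron_mat_1_mult_nth, simp add: transpose_def incidence_def)

text \<open>Equality along edges propagates along undirected paths, and these join any two players.\<close>

lemma incidence_transpose_eq_0_iff_consensus:
  fixes E :: "('p::finite \<times> 'p) set"
  assumes "weakly_connected E" "irrefl E"
  shows "transpose (kron (incidence E) (mat 1)) *v y = 0 \<longleftrightarrow> (\<exists>v. y = kron_vec (1 :: real^'p) v)"
proof
  assume "transpose (kron (incidence E) (mat 1)) *v y = 0"
  then have edge: "y $ (i, k) = y $ (j, k)" if "(j, i) \<in> E" for i j k
    using transpose_kron_incidence_nth[OF \<open>irrefl E\<close>, of y j i k] that by simp
  fix r :: 'p
  have "y $ (i, k) = y $ (r, k)" for i k
  proof -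
    have "(r, i) \<in> (E \<union> E\<inverse>)\<^sup>*"
      using assms(1) by (simp add: weakly_connected_def)
    then show ?thesis
      by (induction rule: rtrancl_induct) (use edge in fastforce)+
  qed
  then have "y = kron_vec 1 (copy y r)"
    by (simp add: vec_eq_iff)
  then show "\<exists>v. y = kron_vec (1 :: real^'p) v" ..
next
  assume "\<exists>v. y = kron_vec (1 :: real^'p) v"
  then show "transpose (kron (incidence E) (mat 1)) *v y = 0"
    by (auto simp: vec_eq_iff transpose_kron_incidence_nth[OF assms(2)])
qed

lemma laplacian_consensus:
  assumes "weakly_connected E" "irrefl E"
  shows "kron (laplacian E) (mat 1) *v kron_vec 1 v = 0"
  using incidence_transpose_eq_0_iff_consensus[OF assms, of "kron_vec 1 v"]
  by (auto simp: laplacian_def kron_mat_1_mult_assoc simp flip: transpose_kron_mat_1)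

text \<open>An undirected path from \<open>r\<close> to \<open>i\<close> carries a unit flow, an edge traversed backwards counting
  with a negative sign.\<close>

lemma unit_flow_exists:
  fixes E :: "('p::finite \<times> 'p) set"
  assumes "weakly_connected E" "irrefl E"
  shows "\<exists>w. (\<forall>e. e \<notin> E \<longrightarrow> w $ e = 0) \<and> incidence E *v w = axis i 1 - axis r 1"
proof -
  have column: "incidence E *v axis (j, i) 1 = axis i 1 - axis j 1" if "(j, i) \<in> E" for i j
    unfolding matrix_vector_mult_basis using that assms(2)
    by (auto simp: column_def vec_eq_iff incidence_def axis_def irrefl_def)
  have "(r, i) \<in> (E \<union> E\<inverse>)\<^sup>*"
    using assms(1) by (simp add: weakly_connected_def)
  then show ?thesis
  proof (induction rule: rtrancl_induct)
    case base
    show ?case by (intro exI[of _ 0]) simp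
  next
    case (step j i)
    then obtain w where w: "\<forall>e. e \<notin> E \<longrightarrow> w $ e = 0" "incidence E *v w = axis j 1 - axis r 1"
      by blast
    from step.hyps(2) consider "(j, i) \<in> E" | "(i, j) \<in> E" by auto
    then show ?case
    proof cases
      case 1
      then show ?thesis
        using w by (intro exI[of _ "w + axis (j, i) 1"])
          (auto simp: matrix_vector_right_distrib column, auto simp: axis_def)
    next
      case 2
      then show ?thesis
        using w by (intro exI[of _ "w - axis (i, j) 1"])
          (auto simp: matrix_vector_mult_diff_distrib column, auto simp: axis_def)
    qed
  qed
qed

text \<open>Routing each player's entry to a common root solves the equation up to the total, which has to
  be absorbed at the root and is zero.\<close>

lemma zero_sum_in_range_kron_incidence:
  fixes E :: "('p::finite \<times> 'p) set" and d :: "real^('p \<times> 'k::finite)"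
  assumes "weakly_connected E" "irrefl E" and sum0: "\<And>k. (\<Sum>i\<in>UNIV. d $ (i, k)) = 0"
  shows "\<exists>z\<in>edge_space E. kron (incidence E) (mat 1) *v z = d"
proof -
  fix r :: 'p
  obtain w where w: "\<And>i e. e \<notin> E \<Longrightarrow> w i $ e = 0"
      "\<And>i. incidence E *v w i = axis i 1 - axis r 1"
    using unit_flow_exists[OF assms(1,2), of _ r] by metis
  define z :: "real^(('p \<times> 'p) \<times> 'k)"
    where "z = (\<chi> s. \<Sum>i\<in>UNIV. d $ (i, snd s) * w i $ fst s)"
  have "(kron (incidence E) (mat 1) *v z) $ (p, k) = d $ (p, k)" for p k
  proof -
    have "(kron (incidence E) (mat 1) *v z) $ (p, k)
        = (\<Sum>e\<in>UNIV. \<Sum>i\<in>UNIV. incidence E $ p $ e * (d $ (i, k) * w i $ e))"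
      by (simp add: kron_mat_1_mult_nth z_def sum_distrib_left)
    also have "\<dots> = (\<Sum>i\<in>UNIV. \<Sum>e\<in>UNIV. incidence E $ p $ e * (d $ (i, k) * w i $ e))"
      by (rule sum.swap)
    also have "\<dots> = (\<Sum>i\<in>UNIV. d $ (i, k) * (incidence E *v w i) $ p)"
      by (simp add: matrix_vector_mult_def sum_distrib_left mult.left_commute)
    also have "\<dots> = (\<Sum>i\<in>UNIV. (if i = p then d $ (i, k) else 0))
        - (\<Sum>i\<in>UNIV. d $ (i, k)) * (if r = p then 1 else 0)"
      by (simp add: w(2) axis_def right_diff_distrib sum_subtractf sum_distrib_right
          mult_delta_right eq_commute)
    also have "\<dots> = d $ (p, k)"
      by (simp add: sum0)
    finally show ?thesis .
  qed
  then have "kron (incidence E) (mat 1) *v z = d"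
    by (simp add: vec_eq_iff)
  moreover have "z \<in> edge_space E"
    by (simp add: edge_space_def z_def w(1))
  ultimately show ?thesis by blast
qed

section \<open>Players' blocks and normal cones\<close>

lemma block_nth [simp]: "block own i x $ c = (if own c = i then x $ c else 0)"
  by (simp add: block_def)

lemma block_of_block_space: "v \<in> block_space own i \<Longrightarrow> block own i v = v"
  by (auto simp: vec_eq_iff block_space_def)

lemma block_in_block_space: "block own i v \<in> block_space own i"
  by (simp add: block_space_def)

lemma inner_block: "block own i u \<bullet> v = block own i u \<bullet> block own i v"
  by (auto simp: inner_vec_def intro!: sum.cong)

lemma normal_cone_iff:
  "u \<in> normal_cone V S x \<longleftrightarrow> x \<in> S \<and> u \<in> V \<and> (\<forall>z\<in>S. u \<bullet> (z - x) \<le> 0)"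
  by (auto simp: normal_cone_def SUP_le_iff)

text \<open>The set $\tilde\Omega$ constrains each player's own block separately and leaves the
  estimates free; normal vectors therefore split into blocks and vanish at the estimates.\<close>

lemma normal_cone_aug_set_iff:
  assumes \<Omega>: "\<And>i. \<Omega> i \<subseteq> block_space own i"
  shows "u \<in> normal_cone UNIV (aug_set own \<Omega>) y \<longleftrightarrow>
    (\<forall>i. block own i (copy u i) \<in> normal_cone (block_space own i) (\<Omega> i) (block own i (copy y i))) \<and>
    (\<forall>i. copy u i \<in> block_space own i)" (is "?L \<longleftrightarrow> ?R")
proof
  assume L: ?L
  then have y: "block own i (copy y i) \<in> \<Omega> i" for i
    by (auto simp: normal_cone_iff aug_set_def)
  have test: "copy u i \<bullet> (v - copy y i) \<le> 0" if v: "block own i v \<in> \<Omega> i" for i v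
  proof -
    \<comment> \<open>Only player \<open>i\<close> moves, so a single summand of the inner product survives.\<close>
    define w where "w = stack (\<lambda>j. if j = i then v else copy y j)"
    have "w \<in> aug_set own \<Omega>"
      using v y by (simp add: w_def aug_set_def)
    then have "u \<bullet> (w - y) \<le> 0"
      using L by (auto simp: normal_cone_iff)
    moreover have "copy u j \<bullet> (copy w j - copy y j)
        = (if j = i then copy u i \<bullet> (v - copy y i) else 0)" for j
      by (simp add: w_def)
    ultimately show ?thesis by (simp add: inner_eq_sum_copies)
  qed
  have "copy u i \<in> block_space own i" for i
  proof -
    define f where "f = copy u i - block own i (copy u i)"
    have "block own i (copy y i + f) = block own i (copy y i)"
      by (simp add: vec_eq_iff f_def)
    then have "copy u i \<bullet> f \<le> 0"
      using test[of i "copy y i + f"] y by simp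
    moreover have "copy u i \<bullet> f = f \<bullet> f"
      by (auto simp: inner_vec_def f_def intro!: sum.cong)
    ultimately have "f = 0"
      by (metis inner_eq_zero_iff inner_ge_zero order_antisym)
    then show ?thesis
      by (metis block_in_block_space eq_iff_diff_eq_0 f_def)
  qed
  moreover have "block own i (copy u i) \<bullet> (z - block own i (copy y i)) \<le> 0" if z: "z \<in> \<Omega> i" for i z
  proof -
    define v where "v = z + (copy y i - block own i (copy y i))"
    have "block own i v = z"
      using z \<Omega>[of i] by (auto simp: vec_eq_iff v_def block_space_def)
    then have "copy u i \<bullet> (v - copy y i) \<le> 0"
      using test z by metis
    then show ?thesis
      using block_of_block_space[OF calculation, of i] by (simp add: v_def)
  qed
  ultimately show ?R
    using y by (auto simp: normal_cone_iff block_in_block_space)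
next
  assume R: ?R
  have "u \<bullet> (w - y) \<le> 0" if w: "w \<in> aug_set own \<Omega>" for w
  proof -
    have "copy u i \<bullet> (copy w i - copy y i) \<le> 0" for i
    proof -
      have "copy u i \<bullet> (copy w i - copy y i)
          = block own i (copy u i) \<bullet> (block own i (copy w i) - block own i (copy y i))"
        using R inner_block[of own i "copy u i" "copy w i"] inner_block[of own i "copy u i" "copy y i"]
        by (simp add: block_of_block_space inner_diff_right)
      then show ?thesis
        using R w by (auto simp: normal_cone_iff aug_set_def)
    qed
    then show ?thesis
      by (simp add: inner_eq_sum_copies sum_nonpos)
  qed
  then show ?L
    using R by (auto simp: normal_cone_iff aug_set_def)
qed

text \<open>Testing against consensual points turns the inner product of the stacks into the inner product
  with the sum of the copies.\<close>

lemma sum_copies_in_normal_cone_orthant: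
  assumes "v \<in> normal_cone UNIV nonneg_orthant (kron_vec (1 :: real^'p::finite) l)"
  shows "(\<Sum>i\<in>UNIV. copy v i) \<in> normal_cone UNIV nonneg_orthant l"
proof -
  have "(\<Sum>i\<in>UNIV. copy v i) \<bullet> (w - l) \<le> 0" if "w \<in> nonneg_orthant" for w
  proof -
    have "kron_vec (1 :: real^'p) w \<in> nonneg_orthant"
      using that by (simp add: nonneg_orthant_def)
    then have "v \<bullet> (kron_vec 1 w - kron_vec 1 l) \<le> 0"
      using assms by (simp add: normal_cone_iff)
    then show ?thesis
      by (simp add: inner_eq_sum_copies inner_sum_left)
  qed
  then show ?thesis
    using assms by (auto simp: normal_cone_iff nonneg_orthant_def)
qed

lemma stack_scaled_in_normal_cone_orthant:
  assumes v: "v \<in> normal_cone UNIV nonneg_orthant l" and "0 \<le> t"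
  shows "stack (\<lambda>_. t *\<^sub>R v) \<in> normal_cone UNIV nonneg_orthant (kron_vec (1 :: real^'p::finite) l)"
proof -
  have "stack (\<lambda>_. t *\<^sub>R v) \<bullet> (w - kron_vec (1 :: real^'p) l) \<le> 0" if "w \<in> nonneg_orthant" for w
  proof -
    have "copy w i \<in> nonneg_orthant" for i
      using that by (simp add: nonneg_orthant_def)
    then have "t * (v \<bullet> (copy w i - l)) \<le> 0" for i
      using v \<open>0 \<le> t\<close> by (simp add: normal_cone_iff mult_nonneg_nonpos)
    then show ?thesis
      by (simp add: inner_eq_sum_copies sum_nonpos)
  qed
  then show ?thesis
    using v by (auto simp: normal_cone_iff nonneg_orthant_def)
qed

section \<open>The two inclusion systems as equations\<close>

lemma transpose_sel_mat_nth:
  "(transpose (sel_mat own) *v v) $ (i, c) = (if own c = i then v $ c else 0)"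
proof -
  have "transpose (sel_mat own) $ (i, c) $ c' * v $ c'
      = (if c' = c then (if own c = i then v $ c else 0) else 0)" for c'
    by (auto simp: transpose_def sel_mat_def)
  then show ?thesis by (simp add: matrix_vector_mult_def)
qed

lemma sel_mat_nth: "(sel_mat own *v y) $ c = y $ (own c, c)"
proof -
  have "sel_mat own $ c $ (i, c') * y $ (i, c')
      = (if c' = c then (if i = own c then y $ (i, c) else 0) else 0)" for i c'
    by (auto simp: sel_mat_def)
  then show ?thesis by (simp add: matrix_vector_mult_def sum_UNIV_prod)
qed

lemma transpose_Lam_mat_nth:
  "(transpose (Lam_mat own A) *v l) $ c = (transpose A *v copy l (own c)) $ c"
proof -
  have "(\<Sum>k\<in>UNIV. transpose (Lam_mat own A) $ c $ (i, k) * l $ (i, k))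
      = (if i = own c then (\<Sum>k\<in>UNIV. A $ k $ c * l $ (i, k)) else 0)" for i
    by (simp add: transpose_def Lam_mat_def)
  then show ?thesis
    by (simp add: matrix_vector_mult_def sum_UNIV_prod) (simp add: transpose_def)
qed

lemma Lam_mat_sel_mat_nth:
  "(Lam_mat own A *v (sel_mat own *v y)) $ (i, k) = (A *v block own i (copy y i)) $ k"
proof -
  have "(Lam_mat own A *v (sel_mat own *v y)) $ (i, k)
      = (\<Sum>c\<in>UNIV. Lam_mat own A $ (i, k) $ c * y $ (own c, c))"
    by (subst matrix_vector_mult_def) (simp add: sel_mat_nth)
  then show ?thesis
    by (auto simp: matrix_vector_mult_def Lam_mat_def intro!: sum.cong)
qed

lemma sum_mult_blocks:
  fixes own :: "'c::finite \<Rightarrow> 'p::finite"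
  shows "(\<Sum>i\<in>UNIV. A *v block own i x) = A *v (x :: real^'c)"
proof -
  have "(\<Sum>i\<in>UNIV. block own i x) = x"
    by (simp add: vec_eq_iff)
  then show ?thesis
    by (metis linear_sum matrix_vector_mul_linear)
qed

lemma transpose_col_block_mult:
  "transpose (col_block own A i) *v l = block own i (transpose A *v l)"
  by (auto simp: vec_eq_iff matrix_vector_mult_def transpose_def col_block_def)

lemma vGNE_iff:
  fixes own :: "'c::finite \<Rightarrow> 'p" and A :: "real^'c^'m::finite"
  shows "vGNE own J \<Omega> A b x l \<longleftrightarrow>
     (\<forall>i. \<exists>g\<in>partial_subdiff own J i x.
        \<exists>u\<in>normal_cone (block_space own i) (\<Omega> i) (block own i x).
          g + block own i (transpose A *v l) + u = 0) \<and>
     A *v x - b \<in> normal_cone UNIV nonneg_orthant l"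
proof -
  have "0 \<in> {- w} + S \<longleftrightarrow> w \<in> S" for w :: "real^'m" and S
    by (auto simp: set_plus_def)
  moreover have "0 \<in> G + {a} + S \<longleftrightarrow> (\<exists>g\<in>G. \<exists>u\<in>S. g + a + u = 0)" for a :: "real^'c" and G S
    by (auto simp: set_plus_def)
  ultimately show ?thesis
    by (simp add: vGNE_def transpose_col_block_mult del: minus_diff_eq)
qed

text \<open>The residuals that have to be compensated by normal vectors, player by player, at a consensual
  point, where the Laplacian terms and the last two rows of $\mathcal T$ have dropped out.\<close>

lemma consensual_zero_iff:
  fixes own :: "'c::finite \<Rightarrow> 'p::finite" and A :: "real^'c^'m::finite"
  assumes "weakly_connected E" "irrefl E"
  shows "(kron_vec (1 :: real^'p) y, kron_vec (1 :: real^'p) l, \<mu>, z) \<in> Zer_T own J \<Omega> A bs E \<rho>\<mu> \<rho>z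
    \<longleftrightarrow> \<mu> \<in> edge_space E \<and> z \<in> edge_space E \<and>
      (\<exists>g. (\<forall>i. block own i g \<in> partial_subdiff own J i y) \<and>
        (\<exists>u\<in>normal_cone UNIV (aug_set own \<Omega>) (kron_vec 1 y). \<forall>i c.
          (if own c = i then g $ c + (transpose A *v l) $ c else 0)
            + (kron (incidence E) (mat 1) *v \<mu>) $ (i, c) + u $ (i, c) = 0)) \<and>
      (\<exists>v\<in>normal_cone UNIV nonneg_orthant (kron_vec (1 :: real^'p) l). \<forall>i k.
          v $ (i, k) - (A *v block own i y) $ k + bs i $ k
            + (kron (incidence E) (mat 1) *v z) $ (i, k) = 0)"
proof -
  have plus3: "0 \<in> f ` G + {a} + S \<longleftrightarrow> (\<exists>g\<in>G. \<exists>u\<in>S. f g + a + u = 0)"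
    for f :: "real^'c \<Rightarrow> real^('p \<times> 'c)" and a G S
    by (auto simp: set_plus_def)
  have plus2: "0 \<in> S + {a} \<longleftrightarrow> (\<exists>v\<in>S. v + a = 0)" for a :: "real^('p \<times> 'm)" and S
    by (auto simp: set_plus_def)
  have consensus: "transpose (kron (incidence E) (mat 1)) *v kron_vec 1 v = 0" for v :: "real^'k::finite"
    using incidence_transpose_eq_0_iff_consensus[OF assms] by blast
  show ?thesis
    unfolding Zer_T_def op_T_def Let_def zero_prod_def
      prod.case mem_Collect_eq mem_Times_iff fst_conv snd_conv plus3 plus2
    by (simp add: consensus laplacian_consensus[OF assms] stacked_eq_0_iff ext_pseudograd_def
        transpose_sel_mat_nth transpose_Lam_mat_nth Lam_mat_sel_mat_nth stack_def Bex_def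
        diff_conv_add_uminus add.assoc del: add_uminus_conv_diff)
qed

section \<open>Zeros and variational equilibria\<close>

lemma zero_is_consensual_vGNE:
  fixes own :: "'c::finite \<Rightarrow> 'p::finite" and A :: "real^'c^'m::finite"
  assumes \<Omega>: "\<And>i. \<Omega> i \<subseteq> block_space own i"
    and graph: "weakly_connected E" "irrefl E"
    and bs: "(\<Sum>i\<in>UNIV. bs i) = b"
    and zero: "(y, l, \<mu>, z) \<in> Zer_T own J \<Omega> A bs E \<rho>\<mu> \<rho>z"
  shows "\<exists>y' l'. y = kron_vec (1 :: real^'p) y' \<and> l = kron_vec (1 :: real^'p) l' \<and>
    vGNE own J \<Omega> A b y' l'"
proof -
  from zero have "transpose (kron (incidence E) (mat 1)) *v y = 0"
      "transpose (kron (incidence E) (mat 1)) *v l = 0"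
    by (auto simp: Zer_T_def op_T_def Let_def zero_prod_def)
  then obtain y' l' where y: "y = kron_vec (1 :: real^'p) y'" and l: "l = kron_vec (1 :: real^'p) l'"
    using incidence_transpose_eq_0_iff_consensus[OF graph] by metis
  obtain g u v where g: "\<And>i. block own i g \<in> partial_subdiff own J i y'"
    and u: "u \<in> normal_cone UNIV (aug_set own \<Omega>) (kron_vec 1 y')"
    and row1: "\<And>i c. (if own c = i then g $ c + (transpose A *v l') $ c else 0)
            + (kron (incidence E) (mat 1) *v \<mu>) $ (i, c) + u $ (i, c) = 0"
    and v: "v \<in> normal_cone UNIV nonneg_orthant (kron_vec (1 :: real^'p) l')"
    and row2: "\<And>i k. v $ (i, k) - (A *v block own i y') $ k + bs i $ k
            + (kron (incidence E) (mat 1) *v z) $ (i, k) = 0"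
    using zero unfolding y l consensual_zero_iff[OF graph] by blast
  note u_blocks = u[unfolded normal_cone_aug_set_iff[OF \<Omega>]]
  have stationary: "g $ c + (transpose A *v l') $ c + u $ (own c, c) = 0" for c
  proof -
    have "u $ (i, c) = (if own c = i then u $ (own c, c) else 0)" for i
      using u_blocks by (auto simp: block_space_def)
    then have "(\<Sum>i\<in>UNIV. u $ (i, c)) = (\<Sum>i\<in>UNIV. if own c = i then u $ (own c, c) else 0)"
      by (rule sum.cong[OF refl])
    then have "(\<Sum>i\<in>UNIV. u $ (i, c)) = u $ (own c, c)"
      by simp
    moreover have "(\<Sum>i\<in>UNIV. (if own c = i then g $ c + (transpose A *v l') $ c else 0)
            + (kron (incidence E) (mat 1) *v \<mu>) $ (i, c) + u $ (i, c)) = 0"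
      by (simp add: row1)
    ultimately show ?thesis
      by (simp add: sum.distrib sum_kron_incidence[OF graph(2)])
  qed
  have "\<exists>g\<in>partial_subdiff own J i y'.
        \<exists>u\<in>normal_cone (block_space own i) (\<Omega> i) (block own i y').
          g + block own i (transpose A *v l') + u = 0" for i
  proof (intro bexI)
    show "block own i g + block own i (transpose A *v l') + block own i (copy u i) = 0"
      using stationary by (auto simp: vec_eq_iff)
    show "block own i (copy u i) \<in> normal_cone (block_space own i) (\<Omega> i) (block own i y')"
      using u_blocks by simp
  qed (rule g)
  moreover have "A *v y' - b = (\<Sum>i\<in>UNIV. copy v i)"
  proof -
    have "(\<Sum>i\<in>UNIV. copy v i) $ k - (A *v y') $ k + b $ k = 0" for k
    proof -
      have "(\<Sum>i\<in>UNIV. (A *v block own i y') $ k) = (A *v y') $ k"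
        by (simp add: sum_mult_blocks flip: sum_component)
      moreover have "(\<Sum>i\<in>UNIV. bs i $ k) = b $ k"
        by (simp flip: bs)
      moreover have "(\<Sum>i\<in>UNIV. v $ (i, k) - (A *v block own i y') $ k + bs i $ k
            + (kron (incidence E) (mat 1) *v z) $ (i, k)) = 0"
        by (simp add: row2)
      ultimately show ?thesis
        by (simp add: sum.distrib sum_subtractf sum_kron_incidence[OF graph(2)])
    qed
    then show ?thesis
      by (simp add: vec_eq_iff algebra_simps)
  qed
  ultimately have "vGNE own J \<Omega> A b y' l'"
    using sum_copies_in_normal_cone_orthant[OF v] by (simp add: vGNE_iff)
  then show ?thesis
    using y l by blast
qed

lemma vGNE_lifts_to_zero:
  fixes own :: "'c::finite \<Rightarrow> 'p::finite" and A :: "real^'c^'m::finite"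
  assumes \<Omega>: "\<And>i. \<Omega> i \<subseteq> block_space own i"
    and graph: "weakly_connected E" "irrefl E"
    and bs: "(\<Sum>i\<in>UNIV. bs i) = b"
    and vGNE: "vGNE own J \<Omega> A b y l"
  shows "\<exists>\<mu> z. (kron_vec (1 :: real^'p) y, kron_vec (1 :: real^'p) l, \<mu>, z)
    \<in> Zer_T own J \<Omega> A bs E \<rho>\<mu> \<rho>z"
proof -
  obtain g u where g: "\<And>i. g i \<in> partial_subdiff own J i y"
    and u: "\<And>i. u i \<in> normal_cone (block_space own i) (\<Omega> i) (block own i y)"
    and stationary: "\<And>i. g i + block own i (transpose A *v l) + u i = 0"
  proof -
    have "\<forall>i. \<exists>g u. g \<in> partial_subdiff own J i y \<and>
        u \<in> normal_cone (block_space own i) (\<Omega> i) (block own i y) \<and>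
        g + block own i (transpose A *v l) + u = 0"
      using conjunct1[OF vGNE[unfolded vGNE_iff]] unfolding Bex_def by simp
    then have "\<exists>g u. \<forall>i. g i \<in> partial_subdiff own J i y \<and>
        u i \<in> normal_cone (block_space own i) (\<Omega> i) (block own i y) \<and>
        g i + block own i (transpose A *v l) + u i = 0"
      unfolding choice_iff .
    then show thesis
      using that by auto
  qed
  have compl: "A *v y - b \<in> normal_cone UNIV nonneg_orthant l"
    using vGNE unfolding vGNE_iff by blast
  have u_block: "u i \<in> block_space own i" for i
    using u by (simp add: normal_cone_iff)
  have g_block: "g i \<in> block_space own i" for i
    using g by (simp add: partial_subdiff_def subdifferential_def)

  define g' where "g' = (\<chi> c. g (own c) $ c)"
  have "block own i g' = g i" for i
    using g_block[of i] by (auto simp: vec_eq_iff g'_def block_space_def)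
  then have "block own i g' \<in> partial_subdiff own J i y" for i
    by (simp add: g)
  moreover have "stack u \<in> normal_cone UNIV (aug_set own \<Omega>) (kron_vec 1 y)"
    using u u_block by (simp add: normal_cone_aug_set_iff[OF \<Omega>] block_of_block_space)
  moreover have "(if own c = i then g' $ c + (transpose A *v l) $ c else 0) + stack u $ (i, c) = 0"
    for i c
    using stationary[of i, unfolded vec_eq_iff, rule_format, of c] u_block[of i]
    by (auto simp: g'_def stack_def block_space_def)
  ultimately have row1: "\<exists>g. (\<forall>i. block own i g \<in> partial_subdiff own J i y) \<and>
        (\<exists>u\<in>normal_cone UNIV (aug_set own \<Omega>) (kron_vec 1 y). \<forall>i c.
          (if own c = i then g $ c + (transpose A *v l) $ c else 0)
            + (kron (incidence E) (mat 1) *v 0) $ (i, c) + u $ (i, c) = 0)"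
    by (intro exI[of _ g'] conjI bexI[of _ "stack u"]) auto

  \<comment> \<open>Any split of \<open>A *v y - b\<close> into normal vectors would do; equal shares stay in the cone.\<close>
  define v where "v = (1 / real CARD('p)) *\<^sub>R (A *v y - b)"
  have v: "stack (\<lambda>_. v) \<in> normal_cone UNIV nonneg_orthant (kron_vec (1 :: real^'p) l)"
    unfolding v_def by (intro stack_scaled_in_normal_cone_orthant compl) simp
  have "(\<Sum>i\<in>UNIV. A *v block own i y - bs i - v) = 0"
  proof -
    have "(\<Sum>i\<in>UNIV. A *v block own i y) = A *v y"
      by (simp add: sum_mult_blocks flip: sum_component)
    moreover have "(\<Sum>i\<in>(UNIV :: 'p set). v) = A *v y - b"
      by (simp add: v_def sum_constant_scaleR del: sum_constant)
    ultimately show ?thesis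
      by (simp add: sum_subtractf bs)
  qed
  then have "(\<Sum>i\<in>UNIV. stack (\<lambda>i. A *v block own i y - bs i - v) $ (i, k)) = 0" for k
    by (simp add: stack_def vec_eq_iff)
  from zero_sum_in_range_kron_incidence[OF graph this]
  obtain z where z: "z \<in> edge_space E"
    "kron (incidence E) (mat 1) *v z = stack (\<lambda>i. A *v block own i y - bs i - v)"
    by blast
  have "(kron_vec (1 :: real^'p) y, kron_vec (1 :: real^'p) l, 0, z) \<in> Zer_T own J \<Omega> A bs E \<rho>\<mu> \<rho>z"
    unfolding consensual_zero_iff[OF graph]
  proof (intro conjI bexI[of _ "stack (\<lambda>_. v)"] allI row1 z(1) v)
    show "0 \<in> edge_space E"
      by (simp add: edge_space_def)
  qed (simp add: z(2) stack_def)
  then show ?thesis by blast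
qed

theorem theorem1:
  fixes own :: "'c::finite \<Rightarrow> 'p::finite"
    and J :: "'p \<Rightarrow> real^'c \<Rightarrow> ereal"
    and \<Omega> :: "'p \<Rightarrow> (real^'c) set"
    and A :: "real^'c^'m::finite"
    and b :: "real^'m"
    and bs :: "'p \<Rightarrow> real^'m"
    and E :: "('p \<times> 'p) set"
    and \<rho>\<mu> \<rho>z :: real
  assumes J: "\<And>i x. proper_on (block_space own i) (partial_cost own J i x)"
      "\<And>i x. lsc_on (block_space own i) (partial_cost own J i x)"
      "\<And>i x. ereal_convex_on (block_space own i) (partial_cost own J i x)"
    and \<Omega>: "\<And>i. \<Omega> i \<subseteq> block_space own i"
      "\<And>i. \<Omega> i \<noteq> {}" "\<And>i. closed (\<Omega> i)" "\<And>i. convex (\<Omega> i)"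
    and X: "feasible_set own \<Omega> A b \<noteq> {}" "slater own \<Omega> A b"
    and graph: "weakly_connected E" "irrefl E"
    and bs: "(\<Sum>i\<in>UNIV. bs i) = b"
    and rho: "0 \<le> \<rho>\<mu>" "0 \<le> \<rho>z"
  shows "(\<forall>y l \<mu> z. (y, l, \<mu>, z) \<in> Zer_T own J \<Omega> A bs E \<rho>\<mu> \<rho>z \<longrightarrow>
            (\<exists>y' l'. y = kron_vec (1 :: real^'p) y' \<and> l = kron_vec (1 :: real^'p) l' \<and>
                     vGNE own J \<Omega> A b y' l'))
       \<and> (\<forall>y l. vGNE own J \<Omega> A b y l \<longrightarrow>
            (\<exists>\<mu> z. (kron_vec (1 :: real^'p) y, kron_vec (1 :: real^'p) l, \<mu>, z)
                     \<in> Zer_T own J \<Omega> A bs E \<rho>\<mu> \<rho>z))"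
  using zero_is_consensual_vGNE[OF \<Omega>(1) graph bs] vGNE_lifts_to_zero[OF \<Omega>(1) graph bs]
  by blast

end
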